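(* Let $G$ be a connected non-complete graph of order $n$, maximum degree $\Delta$ and algebraic connectivity $\mu$. Then the clique number of $G$ satisfies $$\omega(G)\le \frac{n(\Delta-\mu+1)}{n-\mu}.$$
   Context: All graphs are finite and simple. The algebraic connectivity $\mu$ of $G$ is the second smallest eigenvalue of the Laplacian matrix $D-A$ of $G$ ($D$ the diagonal degree matrix, $A$ the adjacency matrix). $\omega(G)$ is the maximum number of vertices of a clique in $G$. *)

theory Defs
  imports
    "Graph_Theory.Graph_Theory"
    "Jordan_Normal_Form.Char_Poly"
begin

text \<open>
  A finite simple graph is a \<^locale>\<open>graph\<close>: a finite symmetric digraph without loops and parallel
  arcs, in which every edge is represented by a pair of opposite arcs. Hence the degree of a vertex
  is its \<^const>\<open>out_degree\<close>, and adjacency is \<open>u \<rightarrow>\<^bsub>G\<^esub> v\<close>.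
\<close>

definition max_degree :: "('a, 'b) pre_digraph \<Rightarrow> nat" where
  "max_degree G = Max (out_degree G ` verts G)"

definition is_clique :: "('a, 'b) pre_digraph \<Rightarrow> 'a set \<Rightarrow> bool" where
  "is_clique G K \<longleftrightarrow> K \<subseteq> verts G \<and> (\<forall>u\<in>K. \<forall>v\<in>K. u \<noteq> v \<longrightarrow> u \<rightarrow>\<^bsub>G\<^esub> v)"

definition clique_number :: "('a, 'b) pre_digraph \<Rightarrow> nat" where
  "clique_number G = Max {card K | K. is_clique G K}"

text \<open>
  Matrices are indexed by \<open>{0..<n}\<close>, so the matrices of a graph are taken with respect to an
  enumeration \<open>vs\<close> of its vertices.
\<close>

definition vertex_enum :: "('a, 'b) pre_digraph \<Rightarrow> 'a list \<Rightarrow> bool" where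
  "vertex_enum G vs \<longleftrightarrow> distinct vs \<and> set vs = verts G"

definition degree_mat :: "('a, 'b) pre_digraph \<Rightarrow> 'a list \<Rightarrow> real mat" where
  "degree_mat G vs = mat (length vs) (length vs)
     (\<lambda>(i, j). if i = j then real (out_degree G (vs ! i)) else 0)"

definition adjacency_mat :: "('a, 'b) pre_digraph \<Rightarrow> 'a list \<Rightarrow> real mat" where
  "adjacency_mat G vs = mat (length vs) (length vs)
     (\<lambda>(i, j). if vs ! i \<rightarrow>\<^bsub>G\<^esub> vs ! j then 1 else 0)"

definition laplacian_mat :: "('a, 'b) pre_digraph \<Rightarrow> 'a list \<Rightarrow> real mat" where
  "laplacian_mat G vs = degree_mat G vs - adjacency_mat G vs"

text \<open>
  The eigenvalues in increasing order, repeated according to their multiplicity as roots of the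
  characteristic polynomial. For a real symmetric matrix of size \<open>n\<close>, such as the Laplacian matrix,
  this list has length \<open>n\<close>.
\<close>

definition sorted_eigenvalues :: "real mat \<Rightarrow> real list" where
  "sorted_eigenvalues A = sorted_list_of_multiset (proots (char_poly A))"

text \<open>
  The second smallest eigenvalue, counted with multiplicity, has index \<open>1\<close>; it is meaningful for
  graphs with at least two vertices. The choice of the enumeration is irrelevant, see
  \<open>algebraic_connectivity_eq\<close> below.
\<close>

definition algebraic_connectivity :: "('a, 'b) pre_digraph \<Rightarrow> real" where
  "algebraic_connectivity G =
     sorted_eigenvalues (laplacian_mat G (SOME vs. vertex_enum G vs)) ! 1"

lemma similar_laplacian_mat:
  assumes us: "vertex_enum G us" and vs: "vertex_enum G vs"
  shows "similar_mat (laplacian_mat G us) (laplacian_mat G vs)"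
proof -
  define n where "n = length us"
  have d: "distinct us" "distinct vs" and s: "set us = set vs"
    using us vs by (auto simp: vertex_enum_def)
  have len: "length us = n" "length vs = n"
    using d s n_def by (metis distinct_card)+
  define L where "L u v = (if u = v then real (out_degree G u) else 0) -
    (if u \<rightarrow>\<^bsub>G\<^esub> v then 1 else (0::real))" for u v
  have lap: "laplacian_mat G ws = mat n n (\<lambda>(i, j). L (ws ! i) (ws ! j))"
    if "distinct ws" "length ws = n" for ws
    using that by (auto simp: laplacian_mat_def degree_mat_def adjacency_mat_def L_def
        nth_eq_iff_index_eq intro!: eq_matI)
  define P where "P xs ys = mat n n (\<lambda>(i, j). if ys ! j = xs ! i then 1 else (0::real))"
    for xs ys :: "'a list"
  have sum_delta: "(\<Sum>k = 0..<n. (if ws ! k = x then 1 else 0) * f (ws ! k)) = f x"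
    if "distinct ws" "length ws = n" "x \<in> set ws" for ws x and f :: "'a \<Rightarrow> real"
  proof -
    have "(\<Sum>k = 0..<n. (if ws ! k = x then 1 else 0) * f (ws ! k)) =
      (\<Sum>y\<in>set ws. (if y = x then 1 else 0) * f y)"
      using that(1,2) by (intro sum.reindex_bij_betw bij_betw_nth) (auto simp: atLeast0LessThan)
    also have "\<dots> = (\<Sum>y\<in>set ws. if y = x then f y else 0)"
      by (intro sum.cong) auto
    also have "\<dots> = f x"
      using that(3) by simp
    finally show ?thesis .
  qed
  have mult_entry: "(M * N) $$ (i, j) = (\<Sum>k = 0..<n. M $$ (i, k) * N $$ (k, j))"
    if "M \<in> carrier_mat n n" "N \<in> carrier_mat n n" "i < n" "j < n" for M N :: "real mat" and i j
    using that by (auto simp: scalar_prod_def)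
  have P_entry: "P xs ys $$ (i, j) = (if ys ! j = xs ! i then 1 else 0)"
    if "i < n" "j < n" for xs ys i j
    using that by (simp add: P_def)
  have Pc: "P xs ys \<in> carrier_mat n n" for xs ys by (simp add: P_def)
  have inv: "P xs ys * P ys xs = 1\<^sub>m n"
    if "distinct xs" "distinct ys" "length xs = n" "length ys = n" "set xs = set ys" for xs ys
  proof (rule eq_matI)
    fix i j assume "i < dim_row (1\<^sub>m n :: real mat)" "j < dim_col (1\<^sub>m n :: real mat)"
    then have ij: "i < n" "j < n" by auto
    have "(P xs ys * P ys xs) $$ (i, j) =
      (\<Sum>k = 0..<n. (if ys ! k = xs ! i then 1 else 0) * (if xs ! j = ys ! k then 1 else (0::real)))"
      unfolding mult_entry[OF Pc Pc ij] using ij by (intro sum.cong refl) (simp add: P_entry)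
    also have "\<dots> = (if xs ! j = xs ! i then 1 else 0)"
      using that ij
      by (intro sum_delta[where f = "\<lambda>y. if xs ! j = y then 1 else 0"]) (simp_all flip: that(5))
    finally show "(P xs ys * P ys xs) $$ (i, j) = 1\<^sub>m n $$ (i, j)"
      using that(1,3) ij by (auto simp: nth_eq_iff_index_eq)
  qed (simp_all add: P_def)
  define B where "B = laplacian_mat G vs"
  have B: "B \<in> carrier_mat n n" "\<And>i j. i < n \<Longrightarrow> j < n \<Longrightarrow> B $$ (i, j) = L (vs ! i) (vs ! j)"
    by (auto simp: B_def lap d len)
  have PB: "(P us vs * B) $$ (i, j) = L (us ! i) (vs ! j)" if "i < n" "j < n" for i j
  proof -
    have "(P us vs * B) $$ (i, j) =
      (\<Sum>k = 0..<n. (if vs ! k = us ! i then 1 else 0) * L (vs ! k) (vs ! j))"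
      unfolding mult_entry[OF Pc B(1) that] using that
      by (intro sum.cong refl) (simp add: P_entry B(2))
    also have "\<dots> = L (us ! i) (vs ! j)"
      using that d s len by (intro sum_delta[where f = "\<lambda>y. L y (vs ! j)"]) (simp_all flip: s)
    finally show ?thesis .
  qed
  have "laplacian_mat G us = P us vs * B * P vs us"
  proof (rule eq_matI)
    fix i j
    assume "i < dim_row (P us vs * B * P vs us)" "j < dim_col (P us vs * B * P vs us)"
    then have ij: "i < n" "j < n" by (auto simp: P_def)
    have "(P us vs * B * P vs us) $$ (i, j) =
      (\<Sum>k = 0..<n. (P us vs * B) $$ (i, k) * P vs us $$ (k, j))"
      using mult_entry[OF mult_carrier_mat[OF Pc B(1)] Pc ij] .
    also have "\<dots> = (\<Sum>k = 0..<n. (if vs ! k = us ! j then 1 else 0) * L (us ! i) (vs ! k))"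
      using ij by (intro sum.cong refl) (auto simp: PB P_entry)
    also have "\<dots> = L (us ! i) (us ! j)"
      using ij d s len by (intro sum_delta[where f = "L (us ! i)"]) (simp_all flip: s)
    finally show "laplacian_mat G us $$ (i, j) = (P us vs * B * P vs us) $$ (i, j)"
      using ij by (simp add: lap d len)
  qed (auto simp: lap d len P_def)
  moreover have "laplacian_mat G us \<in> carrier_mat n n"
    by (simp add: lap d len)
  moreover have "P us vs * P vs us = 1\<^sub>m n" "P vs us * P us vs = 1\<^sub>m n"
    using inv[OF d len s] inv[OF d(2,1) len(2,1) s[symmetric]] .
  ultimately have "similar_mat (laplacian_mat G us) B"
    using B(1) Pc by (intro similar_matI[where n = n and P = "P us vs" and Q = "P vs us"]) blast+
  then show ?thesis
    by (simp only: B_def)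
qed

lemma algebraic_connectivity_eq:
  assumes "vertex_enum G vs"
  shows "algebraic_connectivity G = sorted_eigenvalues (laplacian_mat G vs) ! 1"
proof -
  have "vertex_enum G (SOME vs. vertex_enum G vs)"
    using assms by (rule someI)
  then show ?thesis
    unfolding algebraic_connectivity_def sorted_eigenvalues_def
    using char_poly_similar[OF similar_laplacian_mat[OF _ assms]] by simp
qed

end

theory Submission
  imports Defs "HOL-Analysis.Function_Topology"
begin

text \<open>
  Over the sums-to-zero vectors of norm one the Dirichlet form of the Laplacian has a minimiser, by
  compactness, and it is an eigenvector. Its eigenvalue is positive because the graph is connected,
  so, \<open>0\<close> being another eigenvalue, it is at least \<open>\<mu>\<close>. This gives \<open>\<mu> |y|\<^sup>2 \<le> y\<^sup>T L y\<close> for all \<open>y\<close>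
  with entries summing to zero. The vector \<open>n 1\<^sub>K - |K| 1\<close> yields \<open>\<mu> |K| (n - |K|) \<le> n e(K, V - K)\<close>.
  For a maximum clique of size \<open>\<omega>\<close> at most \<open>\<omega> (\<Delta> - \<omega> + 1)\<close> edges leave \<open>K\<close>, which is the claim,
  and for a single vertex with a non-neighbour the inequality shows \<open>\<mu> < n\<close>.
\<close>

section \<open>The Laplacian as an operator on functions\<close>

text \<open>For \<open>w\<close> the adjacency indicator of a graph on \<open>V\<close> this is D -
  A acting on functions. Written with differences, it visibly annihilates constants.\<close>

definition lap :: "('a \<Rightarrow> 'a \<Rightarrow> real) \<Rightarrow> 'a set \<Rightarrow> ('a \<Rightarrow> real) \<Rightarrow> 'a \<Rightarrow> real" where
  "lap w V f u = (\<Sum>v\<in>V. w u v * (f u - f v))"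

definition dirichlet :: "('a \<Rightarrow> 'a \<Rightarrow> real) \<Rightarrow> 'a set \<Rightarrow> ('a \<Rightarrow> real) \<Rightarrow> ('a \<Rightarrow> real) \<Rightarrow> real" where
  "dirichlet w V f g = (\<Sum>u\<in>V. f u * lap w V g u)"

text \<open>Symmetrisation: exchange the names of \<open>u\<close> and \<open>v\<close> in the
  double sum and add the two versions. Symmetry of the form, its sign and its invariance under
  adding constants can all be read off the right-hand side.\<close>

lemma dirichlet_eq:
  assumes "\<And>u v. w u v = w v u"
  shows "2 * dirichlet w V f g = (\<Sum>u\<in>V. \<Sum>v\<in>V. w u v * (f u - f v) * (g u - g v))"
proof -
  have 1: "dirichlet w V f g = (\<Sum>u\<in>V. \<Sum>v\<in>V. w u v * f u * (g u - g v))"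
    by (simp add: dirichlet_def lap_def sum_distrib_left mult_ac)
  have "dirichlet w V f g = (\<Sum>v\<in>V. \<Sum>u\<in>V. w u v * f u * (g u - g v))"
    unfolding 1 by (rule sum.swap)
  also have "\<dots> = (\<Sum>u\<in>V. \<Sum>v\<in>V. w u v * f v * (g v - g u))"
    using assms by simp
  finally have "2 * dirichlet w V f g =
    (\<Sum>u\<in>V. \<Sum>v\<in>V. w u v * f u * (g u - g v)) + (\<Sum>u\<in>V. \<Sum>v\<in>V. w u v * f v * (g v - g u))"
    using 1 by simp
  then show ?thesis
    by (simp add: sum.distrib[symmetric] algebra_simps)
qed

lemma dirichlet_commute:
  assumes "\<And>u v. w u v = w v u"
  shows "dirichlet w V f g = dirichlet w V g f"
  using dirichlet_eq[of w V f g] dirichlet_eq[of w V g f] assms by (simp add: mult_ac)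

lemma dirichlet_scale: "dirichlet w V (\<lambda>u. c * f u) (\<lambda>u. c * f u) = c\<^sup>2 * dirichlet w V f f"
  by (simp add: dirichlet_def lap_def sum_distrib_left power2_eq_square algebra_simps)

lemma lap_add_scale: "lap w V (\<lambda>u. f u + t * g u) u = lap w V f u + t * lap w V g u"
  by (simp add: lap_def sum_distrib_left sum.distrib[symmetric] algebra_simps)

lemma dirichlet_add_scale:
  assumes "\<And>u v. w u v = w v u"
  shows "dirichlet w V (\<lambda>u. f u + t * g u) (\<lambda>u. f u + t * g u) =
    dirichlet w V f f + 2 * t * dirichlet w V g f + t\<^sup>2 * dirichlet w V g g"
proof -
  have "dirichlet w V (\<lambda>u. f u + t * g u) (\<lambda>u. f u + t * g u) =
    dirichlet w V f f + t * dirichlet w V f g + t * dirichlet w V g f + t\<^sup>2 * dirichlet w V g g"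
    by (simp add: dirichlet_def lap_add_scale sum_distrib_left sum.distrib[symmetric]
        power2_eq_square algebra_simps)
  then show ?thesis
    using dirichlet_commute[of w V f g] assms by simp
qed

text \<open>Pairing with the constant 1 makes all differences vanish. Hence the operator maps into
  the sums-to-zero functions.\<close>

lemma sum_lap_eq_0:
  assumes "\<And>u v. w u v = w v u"
  shows "(\<Sum>u\<in>V. lap w V f u) = 0"
  using dirichlet_eq[of w V "\<lambda>_. 1" f] assms by (simp add: dirichlet_def)

section \<open>Minimising the Dirichlet form\<close>

lemma dirichlet_minimiser:
  fixes w :: "'a \<Rightarrow> 'a \<Rightarrow> real"
  assumes fin: "finite V" and card: "2 \<le> card V"
  obtains x where "(\<Sum>u\<in>V. x u) = 0" "(\<Sum>u\<in>V. (x u)\<^sup>2) = 1"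
    "\<And>y. (\<Sum>u\<in>V. y u) = 0 \<Longrightarrow> dirichlet w V x x * (\<Sum>u\<in>V. (y u)\<^sup>2) \<le> dirichlet w V y y"
proof -
  \<comment> \<open>Coordinates outside \<open>V\<close> are pinned to 0, so \<open>B\<close> is a
    product of compact sets and Tychonoff applies even if the vertex type is infinite.\<close>
  define B where "B = PiE UNIV (\<lambda>u. if u \<in> V then {-1..1} else {0::real})"
  define S where "S = B \<inter> {x. (\<Sum>u\<in>V. x u) = 0 \<and> (\<Sum>u\<in>V. (x u)\<^sup>2) = 1}"
  have cont: "continuous_on UNIV (\<lambda>x :: 'a \<Rightarrow> real. x u)" for u
    by simp
  have "compactin (product_topology (\<lambda>_. euclidean) UNIV) B"
    unfolding B_def compactin_PiE by auto
  then have "compact B"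
    by (simp add: euclidean_product_topology)
  moreover have "closed {x :: 'a \<Rightarrow> real. (\<Sum>u\<in>V. x u) = 0 \<and> (\<Sum>u\<in>V. (x u)\<^sup>2) = 1}"
    by (intro closed_Collect_conj closed_Collect_eq continuous_intros cont)
  ultimately have "compact S"
    unfolding S_def by (rule compact_Int_closed)
  \<comment> \<open>Normalisation: nonzero sums-to-zero vectors scale into \<open>S\<close>, which
    carries the minimum over \<open>S\<close> to all of them.\<close>
  have SI: "(\<lambda>u. if u \<in> V then x u / sqrt (\<Sum>u\<in>V. (x u)\<^sup>2) else 0) \<in> S"
    if "(\<Sum>u\<in>V. x u) = 0" "(\<Sum>u\<in>V. (x u)\<^sup>2) > 0" for x :: "'a \<Rightarrow> real"
  proof -
    define s where "s = sqrt (\<Sum>u\<in>V. (x u)\<^sup>2)"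
    have s: "s > 0" "s\<^sup>2 = (\<Sum>u\<in>V. (x u)\<^sup>2)"
      using that by (auto simp: s_def)
    have abs_le: "\<bar>x u\<bar> \<le> s" if "u \<in> V" for u
      unfolding s_def using that fin by (intro real_le_rsqrt)
        (simp add: member_le_sum[where f = "\<lambda>u. (x u)\<^sup>2"])
    have "- 1 \<le> x u / s \<and> x u / s \<le> 1" if "u \<in> V" for u
      using abs_le[OF that] s(1) by (auto simp: field_simps)
    moreover have "(\<Sum>u\<in>V. x u / s) = 0"
      using that by (simp add: sum_divide_distrib[symmetric])
    moreover have "(\<Sum>u\<in>V. (x u / s)\<^sup>2) = 1"
      using that(2) s(2) by (simp add: power_divide sum_divide_distrib[symmetric])
    ultimately show ?thesis
      by (auto simp: S_def B_def PiE_iff simp flip: s_def)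
  qed
  obtain a b where ab: "a \<in> V" "b \<in> V" "a \<noteq> b"
    using card fin by (metis card_2_iff' card_le_Suc0_iff_eq not_less_eq_eq numeral_2_eq_2)
  \<comment> \<open>The difference of two unit vectors witnesses that \<open>S\<close> is nonempty;
    this requires two vertices.\<close>
  define z where "z u = (if u = a then 1 else 0) - (if u = b then 1 else (0::real))" for u
  have "(\<Sum>u\<in>V. z u) = 0"
    using ab fin by (simp add: z_def sum_subtractf)
  moreover have "(\<Sum>u\<in>V. (z u)\<^sup>2) > 0"
    using ab fin by (intro sum_pos2[of _ a]) (auto simp: z_def)
  ultimately have "S \<noteq> {}"
    using SI[of z] by (metis empty_iff)
  moreover have "continuous_on S (\<lambda>x. dirichlet w V x x)"
    unfolding dirichlet_def lap_def
    by (intro continuous_intros continuous_on_subset[OF cont]) auto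
  ultimately have "\<exists>x\<in>S. \<forall>y\<in>S. dirichlet w V x x \<le> dirichlet w V y y"
    by (rule continuous_attains_inf[OF \<open>compact S\<close>])
  then obtain x where x: "x \<in> S" "\<And>y. y \<in> S \<Longrightarrow> dirichlet w V x x \<le> dirichlet w V y y"
    by blast
  show thesis
  proof
    show "(\<Sum>u\<in>V. x u) = 0" "(\<Sum>u\<in>V. (x u)\<^sup>2) = 1"
      using x(1) by (auto simp: S_def)
    fix y :: "'a \<Rightarrow> real" assume y: "(\<Sum>u\<in>V. y u) = 0"
    define q where "q = (\<Sum>u\<in>V. (y u)\<^sup>2)"
    show "dirichlet w V x x * (\<Sum>u\<in>V. (y u)\<^sup>2) \<le> dirichlet w V y y"
    proof (cases "q = 0")
      case True
      then have "\<forall>u\<in>V. y u = 0"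
        using fin by (simp add: q_def sum_nonneg_eq_0_iff)
      then show ?thesis
        using True by (simp add: q_def[symmetric] dirichlet_def)
    next
      case False
      then have q: "q > 0"
        by (simp add: q_def less_le sum_nonneg)
      have "dirichlet w V x x \<le> dirichlet w V (\<lambda>u. if u \<in> V then y u / sqrt q else 0)
        (\<lambda>u. if u \<in> V then y u / sqrt q else 0)"
        using SI[OF y] q unfolding q_def[symmetric] by (intro x(2)) auto
      also have "\<dots> = dirichlet w V (\<lambda>u. (1 / sqrt q) * y u) (\<lambda>u. (1 / sqrt q) * y u)"
        unfolding dirichlet_def lap_def by (intro sum.cong refl) simp
      also have "\<dots> = dirichlet w V y y / q"
        unfolding dirichlet_scale using q by (simp add: power_divide)
      finally show ?thesis
        using q by (simp add: q_def[symmetric] field_simps)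
    qed
  qed
qed

text \<open>Near 0 the linear term dominates. The choice t = -c/e with e > |d| makes the value
  negative whatever the sign of \<open>d\<close>.\<close>

lemma linear_coeff_eq_0:
  fixes c d :: real
  assumes "\<And>t. 0 \<le> t * c + t\<^sup>2 * d"
  shows "c = 0"
proof (rule ccontr)
  assume c: "c \<noteq> 0"
  define e where "e = \<bar>d\<bar> + 1"
  have e: "e > 0" "d < e" by (auto simp: e_def)
  have "0 \<le> (- c / e) * c + (- c / e)\<^sup>2 * d"
    by (rule assms)
  also have "\<dots> = (c\<^sup>2 / e\<^sup>2) * (d - e)"
    using e(1) by (simp add: field_simps power2_eq_square)
  also have "\<dots> < 0"
    using c e by (intro mult_pos_neg) auto
  finally show False by simp
qed

text \<open>First variation in the direction of the residual of the eigenvalue equation. The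
  residual itself sums to zero, so it is an admissible direction, and stationarity says that its
  norm is 0.\<close>

lemma minimiser_is_eigenfunction:
  assumes fin: "finite V" and sym: "\<And>u v. w u v = w v u"
    and x: "(\<Sum>u\<in>V. x u) = 0" "(\<Sum>u\<in>V. (x u)\<^sup>2) = 1"
    and min: "\<And>y. (\<Sum>u\<in>V. y u) = 0 \<Longrightarrow>
      dirichlet w V x x * (\<Sum>u\<in>V. (y u)\<^sup>2) \<le> dirichlet w V y y"
    and u: "u \<in> V"
  shows "lap w V x u = dirichlet w V x x * x u"
proof -
  define m where "m = dirichlet w V x x"
  define y where "y u = lap w V x u - m * x u" for u
  have y0: "(\<Sum>u\<in>V. y u) = 0"
    using sum_lap_eq_0[OF sym] x(1) by (simp add: y_def sum_subtractf sum_distrib_left[symmetric])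
  have "0 \<le> t * (2 * (dirichlet w V y x - m * (\<Sum>u\<in>V. y u * x u))) +
    t\<^sup>2 * (dirichlet w V y y - m * (\<Sum>u\<in>V. (y u)\<^sup>2))" for t
  proof -
    have "(\<Sum>u\<in>V. x u + t * y u) = 0"
      using x(1) y0 by (simp add: sum.distrib sum_distrib_left[symmetric])
    from min[OF this] have "m * (\<Sum>u\<in>V. (x u + t * y u)\<^sup>2) \<le>
      m + 2 * t * dirichlet w V y x + t\<^sup>2 * dirichlet w V y y"
      unfolding dirichlet_add_scale[OF sym] m_def by simp
    moreover have "(\<Sum>u\<in>V. (x u + t * y u)\<^sup>2) =
      (\<Sum>u\<in>V. (x u)\<^sup>2) + 2 * t * (\<Sum>u\<in>V. y u * x u) + t\<^sup>2 * (\<Sum>u\<in>V. (y u)\<^sup>2)"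
      by (simp add: sum_distrib_left sum.distrib[symmetric] power2_eq_square algebra_simps)
    ultimately show ?thesis
      using x(2) by (simp add: algebra_simps)
  qed
  then have "2 * (dirichlet w V y x - m * (\<Sum>u\<in>V. y u * x u)) = 0"
    by (rule linear_coeff_eq_0)
  \<comment> \<open>The linear coefficient pairs \<open>y\<close> with the residual, which is
    \<open>y\<close> again.\<close>
  moreover have "(\<Sum>u\<in>V. y u * y u) = dirichlet w V y x - m * (\<Sum>u\<in>V. y u * x u)"
    unfolding dirichlet_def sum_distrib_left sum_subtractf[symmetric]
    by (intro sum.cong refl) (simp add: y_def algebra_simps)
  ultimately have "(\<Sum>u\<in>V. y u * y u) = 0"
    by simp
  then have "y u = 0"
    using fin u by (simp add: sum_nonneg_eq_0_iff)
  then show ?thesis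
    by (simp add: y_def m_def)
qed

text \<open>The shift by \<open>d\<close> cancels in differences and \<open>c\<close> factors out as
  a square. For the indicator of \<open>K\<close>, only pairs from \<open>K\<close> to its
  complement survive.\<close>

lemma dirichlet_cut:
  assumes fin: "finite V" and sym: "\<And>u v. w u v = w v u" and K: "K \<subseteq> V"
    and y: "\<And>u. y u = c * of_bool (u \<in> K) - d"
  shows "dirichlet w V y y = c\<^sup>2 * (\<Sum>u\<in>K. \<Sum>v\<in>V - K. w u v)"
proof -
  define f where "f u = (of_bool (u \<in> K) :: real)" for u
  have "2 * dirichlet w V y y = c\<^sup>2 * (2 * dirichlet w V f f)"
    unfolding dirichlet_eq[OF sym] sum_distrib_left y f_def
    by (intro sum.cong refl) (simp add: power2_eq_square algebra_simps)
  moreover have "dirichlet w V f f = (\<Sum>u\<in>K. lap w V f u)"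
    unfolding dirichlet_def using fin K
    by (intro sum.mono_neutral_cong_right) (auto simp: f_def)
  moreover have "\<dots> = (\<Sum>u\<in>K. \<Sum>v\<in>V - K. w u v)"
    unfolding lap_def using fin
    by (intro sum.cong refl sum.mono_neutral_cong_right) (auto simp: f_def)
  ultimately show ?thesis by simp
qed

section \<open>The second smallest Laplacian eigenvalue\<close>

text \<open>The strictly smaller \<open>a\<close> stands before \<open>b\<close> in the sorted list,
  so the position of \<open>b\<close> is at least 1.\<close>

lemma sorted_list_of_multiset_nth_1_le:
  fixes a b :: "'a :: linorder"
  assumes "a \<in># M" "b \<in># M" "a < b"
  shows "sorted_list_of_multiset M ! 1 \<le> b"
proof -
  let ?xs = "sorted_list_of_multiset M"
  have "a \<in> set ?xs" "b \<in> set ?xs"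
    using assms by simp_all
  then obtain i j where ij: "i < length ?xs" "?xs ! i = a" "j < length ?xs" "?xs ! j = b"
    by (metis in_set_conv_nth)
  have "i < j"
    using ij assms(3) sorted_nth_mono[OF sorted_sorted_list_of_multiset, of j i M]
    by (metis leD leI)
  then have "?xs ! 1 \<le> ?xs ! j"
    using ij by (intro sorted_nth_mono) auto
  with ij show ?thesis by simp
qed

lemma laplacian_mat_carrier: "laplacian_mat G vs \<in> carrier_mat (length vs) (length vs)"
  unfolding laplacian_mat_def degree_mat_def adjacency_mat_def by (intro minus_carrier_mat mat_carrier)

abbreviation adj :: "('a, 'b) pre_digraph \<Rightarrow> 'a \<Rightarrow> 'a \<Rightarrow> real" where
  "adj G u v \<equiv> of_bool (u \<rightarrow>\<^bsub>G\<^esub> v)"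

context graph
begin

lemma adj_commute: "adj G u v = adj G v u"
  using graph_symmetric by auto

text \<open>Out-degree counts arcs; without parallel arcs, taking heads is a bijection onto the
  neighbours.\<close>

lemma out_degree_eq_card: "out_degree G u = card {v \<in> verts G. u \<rightarrow> v}"
proof -
  have "bij_betw (head G) (out_arcs G u) {v \<in> verts G. u \<rightarrow> v}"
    unfolding bij_betw_def
  proof
    show "inj_on (head G) (out_arcs G u)"
      by (intro inj_onI no_multi_arcs) (auto simp: out_arcs_def arc_to_ends_def)
    show "head G ` out_arcs G u = {v \<in> verts G. u \<rightarrow> v}"
      by (force simp: out_arcs_def arcs_ends_conv)
  qed
  then show ?thesis
    unfolding out_degree_def by (rule bij_betw_same_card)
qed

lemma sum_adj_eq_card: "finite A \<Longrightarrow> (\<Sum>v\<in>A. adj G u v) = real (card {v \<in> A. u \<rightarrow> v})"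
  by (simp add: Collect_conj_eq Int_commute flip: sum.inter_filter)

text \<open>Listing the values of an eigenfunction along \<open>vs\<close> gives an eigenvector of
  the matrix. This is the passage from functions to matrices.\<close>

lemma eigenvalue_laplacian_mat:
  assumes vs: "vertex_enum G vs"
    and f: "\<And>u. u \<in> verts G \<Longrightarrow> lap (adj G) (verts G) f u = k * f u"
    and nz: "\<exists>u\<in>verts G. f u \<noteq> 0"
  shows "eigenvalue (laplacian_mat G vs) k"
proof -
  define n where "n = length vs"
  define x where "x = vec n (\<lambda>i. f (vs ! i))"
  have d: "distinct vs" and s: "set vs = verts G"
    using vs by (auto simp: vertex_enum_def)
  have dim: "laplacian_mat G vs \<in> carrier_mat n n"
    by (simp add: laplacian_mat_carrier n_def)
  have sum_vs: "(\<Sum>j = 0..<n. g (vs ! j)) = (\<Sum>v\<in>verts G. g v)" for g :: "'a \<Rightarrow> real"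
    unfolding s[symmetric] n_def using d
    by (intro sum.reindex_bij_betw bij_betw_nth) (auto simp: atLeast0LessThan)
  have "laplacian_mat G vs *\<^sub>v x = k \<cdot>\<^sub>v x"
  proof (rule eq_vecI)
    fix i assume "i < dim_vec (k \<cdot>\<^sub>v x)"
    then have i: "i < n" by (simp add: x_def)
    then have u: "vs ! i \<in> verts G" using i by (simp add: n_def flip: s)
    have "(laplacian_mat G vs *\<^sub>v x) $ i = (\<Sum>j = 0..<n. laplacian_mat G vs $$ (i, j) * x $ j)"
      using i dim by (simp add: scalar_prod_def x_def)
    also have "\<dots> = (\<Sum>j = 0..<n. (if vs ! j = vs ! i then out_degree G (vs ! i) * f (vs ! i) else 0) -
      adj G (vs ! i) (vs ! j) * f (vs ! j))"
      using i d by (intro sum.cong refl) (auto simp: laplacian_mat_def degree_mat_def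
          adjacency_mat_def x_def n_def nth_eq_iff_index_eq algebra_simps)
    also have "\<dots> = (\<Sum>v\<in>verts G. (if v = vs ! i then out_degree G (vs ! i) * f (vs ! i) else 0) -
      adj G (vs ! i) v * f v)"
      by (rule sum_vs)
    also have "\<dots> = out_degree G (vs ! i) * f (vs ! i) - (\<Sum>v\<in>verts G. adj G (vs ! i) v * f v)"
      using u by (simp add: sum_subtractf)
    also have "\<dots> = lap (adj G) (verts G) f (vs ! i)"
      unfolding lap_def out_degree_eq_card sum_adj_eq_card[OF finite_verts, symmetric]
      by (simp add: sum_distrib_right sum_subtractf algebra_simps)
    also have "\<dots> = (k \<cdot>\<^sub>v x) $ i"
      using f[OF u] i by (simp add: x_def)
    finally show "(laplacian_mat G vs *\<^sub>v x) $ i = (k \<cdot>\<^sub>v x) $ i" .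
  qed (use dim in \<open>simp add: x_def\<close>)
  moreover have "x \<noteq> 0\<^sub>v n"
  proof
    assume "x = 0\<^sub>v n"
    then have "f (vs ! i) = 0" if "i < n" for i
      using that by (metis index_vec index_zero_vec(1) x_def)
    then show False
      using nz s n_def by (metis in_set_conv_nth)
  qed
  ultimately have "eigenvector (laplacian_mat G vs) x k"
    using dim by (auto simp: eigenvector_def x_def)
  then show ?thesis
    by (auto simp: eigenvalue_def)
qed

text \<open>Constants give the eigenvalue 0, strictly below \<open>k\<close>, so \<open>k\<close>
  cannot be the first entry of the sorted spectrum.\<close>

lemma algebraic_connectivity_le_eigenvalue:
  assumes "\<And>u. u \<in> verts G \<Longrightarrow> lap (adj G) (verts G) f u = k * f u"
    and "\<exists>u\<in>verts G. f u \<noteq> 0" and "k > 0"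
  shows "algebraic_connectivity G \<le> k"
proof -
  obtain vs where vs: "vertex_enum G vs"
    using finite_distinct_list[OF finite_verts] by (auto simp: vertex_enum_def)
  define A where "A = laplacian_mat G vs"
  have A: "A \<in> carrier_mat (length vs) (length vs)"
    by (simp add: A_def laplacian_mat_carrier)
  \<comment> \<open>For a nonzero polynomial, membership in \<open>proots\<close> means being a
    root.\<close>
  have nz: "char_poly A \<noteq> 0"
    using degree_monic_char_poly[OF A] by auto
  have "eigenvalue A k"
    unfolding A_def using vs assms(1,2) by (rule eigenvalue_laplacian_mat)
  moreover have "eigenvalue A 0"
    unfolding A_def using assms(2)
    by (intro eigenvalue_laplacian_mat[OF vs, of "\<lambda>_. 1"]) (auto simp: lap_def)
  ultimately have "k \<in># proots (char_poly A)" "0 \<in># proots (char_poly A)"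
    using nz by (simp_all add: eigenvalue_root_char_poly[OF A])
  then have "sorted_eigenvalues A ! 1 \<le> k"
    unfolding sorted_eigenvalues_def using assms(3) by (intro sorted_list_of_multiset_nth_1_le)
  then show ?thesis
    by (simp add: algebraic_connectivity_eq[OF vs] A_def)
qed

section \<open>Connectedness and the cut inequality\<close>

text \<open>If the sum of squares over edges vanishes, \<open>x\<close> is constant along edges,
  hence on the connected graph, and then sum zero forces it to be 0.\<close>

lemma dirichlet_pos:
  assumes con: "Digraph_Component.connected G"
    and x: "(\<Sum>u\<in>verts G. x u) = 0" "\<exists>u\<in>verts G. x u \<noteq> 0"
  shows "dirichlet (adj G) (verts G) x x > 0"
proof (rule ccontr)
  assume "\<not> dirichlet (adj G) (verts G) x x > 0"
  moreover have eq: "2 * dirichlet (adj G) (verts G) x x =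
    (\<Sum>u\<in>verts G. \<Sum>v\<in>verts G. adj G u v * (x u - x v)\<^sup>2)"
    using dirichlet_eq[of "adj G", OF adj_commute] by (simp add: power2_eq_square mult.assoc)
  moreover have "(\<Sum>u\<in>verts G. \<Sum>v\<in>verts G. adj G u v * (x u - x v)\<^sup>2) \<ge> 0"
    by (intro sum_nonneg) auto
  ultimately have "(\<Sum>u\<in>verts G. \<Sum>v\<in>verts G. adj G u v * (x u - x v)\<^sup>2) = 0"
    by linarith
  then have "\<forall>u\<in>verts G. \<forall>v\<in>verts G. adj G u v * (x u - x v)\<^sup>2 = 0"
    by (simp add: sum_nonneg_eq_0_iff sum_nonneg)
  then have step: "x u = x v" if "u \<rightarrow> v" for u v
    using that adj_in_verts[OF that] by force
  obtain a where a: "a \<in> verts G" "x a \<noteq> 0" using x(2) by blast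
  have "x a = x v" if v: "v \<in> verts G" for v
  proof -
    \<comment> \<open>\<open>connected\<close> speaks of the symmetrised digraph; as the arcs are
      symmetric, reachability there is reachability in \<open>G\<close>.\<close>
    have "a \<rightarrow>\<^sup>* v"
      using con a v by (metis connected_def pverts_mk_symmetric reachable_mk_symmetric_eq
          strongly_connectedE sym_arcs with_proj_simps(1))
    then show ?thesis
      by (induct rule: reachable_induct) (auto dest: step)
  qed
  then have "(\<Sum>u\<in>verts G. x u) = card (verts G) * x a"
    by (simp flip: sum_constant cong: sum.cong)
  with x(1) a show False by auto
qed

lemma cut_bound:
  assumes con: "Digraph_Component.connected G" and n: "2 \<le> card (verts G)" and K: "K \<subseteq> verts G"
  shows "algebraic_connectivity G * (real (card K) * (real (card (verts G)) - real (card K)))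
    \<le> real (card (verts G)) * (\<Sum>u\<in>K. \<Sum>v\<in>verts G - K. adj G u v)"
proof -
  define n k where "n = real (card (verts G))" and "k = real (card K)"
  obtain x where x: "(\<Sum>u\<in>verts G. x u) = 0" "(\<Sum>u\<in>verts G. (x u)\<^sup>2) = 1"
    and min: "\<And>y. (\<Sum>u\<in>verts G. y u) = 0 \<Longrightarrow>
      dirichlet (adj G) (verts G) x x * (\<Sum>u\<in>verts G. (y u)\<^sup>2) \<le> dirichlet (adj G) (verts G) y y"
    using dirichlet_minimiser[OF finite_verts n] by metis
  define m where "m = dirichlet (adj G) (verts G) x x"
  have nz: "\<exists>u\<in>verts G. x u \<noteq> 0"
    by (rule ccontr) (use x(2) in simp)
  have le: "algebraic_connectivity G \<le> m"
    unfolding m_def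
    using minimiser_is_eigenfunction[OF finite_verts adj_commute x min] nz dirichlet_pos[OF con x(1) nz]
    by (rule algebraic_connectivity_le_eigenvalue)
  \<comment> \<open>This is \<open>n\<close> times the projection of the indicator of
    \<open>K\<close> onto the sums-to-zero vectors.\<close>
  define y where "y u = n * of_bool (u \<in> K) - k" for u
  have ind: "(\<Sum>u\<in>verts G. of_bool (u \<in> K)) = k"
    using K by (simp add: k_def Int_absorb1)
  have "(\<Sum>u\<in>verts G. y u) = 0"
    by (simp add: y_def sum_subtractf sum_distrib_left[symmetric] ind n_def del: sum_of_bool_eq)
  from min[OF this] have "m * (\<Sum>u\<in>verts G. (y u)\<^sup>2) \<le>
      n\<^sup>2 * (\<Sum>u\<in>K. \<Sum>v\<in>verts G - K. adj G u v)"
    unfolding m_def[symmetric] dirichlet_cut[OF finite_verts adj_commute K y_def] .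
  moreover have "(\<Sum>u\<in>verts G. (y u)\<^sup>2) = n * (k * (n - k))"
  proof -
    \<comment> \<open>The indicator is its own square, so the square is affine in it.\<close>
    have "(y u)\<^sup>2 = (n\<^sup>2 - 2 * n * k) * of_bool (u \<in> K) + k\<^sup>2" for u
      by (simp add: y_def power2_eq_square algebra_simps)
    then have "(\<Sum>u\<in>verts G. (y u)\<^sup>2) = (n\<^sup>2 - 2 * n * k) * k + n * k\<^sup>2"
      by (simp add: sum.distrib sum_distrib_left[symmetric] ind n_def del: sum_of_bool_eq)
    then show ?thesis
      by (simp add: power2_eq_square algebra_simps)
  qed
  ultimately have "n * (m * (k * (n - k))) \<le> n * (n * (\<Sum>u\<in>K. \<Sum>v\<in>verts G - K. adj G u v))"
    by (simp only: power2_eq_square mult_ac)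
  moreover have "n > 0" "k \<ge> 0" "k \<le> n"
    using n card_mono[OF finite_verts K] by (auto simp: n_def k_def)
  ultimately have "m * (k * (n - k)) \<le> n * (\<Sum>u\<in>K. \<Sum>v\<in>verts G - K. adj G u v)"
    by simp
  moreover have "algebraic_connectivity G * (k * (n - k)) \<le> m * (k * (n - k))"
    using le \<open>k \<ge> 0\<close> \<open>k \<le> n\<close> by (intro mult_right_mono) auto
  ultimately show ?thesis
    by (simp add: n_def k_def)
qed

section \<open>Degrees, maximum cliques and the final bound\<close>

lemma out_degree_le_max_degree: "u \<in> verts G \<Longrightarrow> out_degree G u \<le> max_degree G"
  unfolding max_degree_def by (intro Max_ge) auto

lemma clique_number_attained:
  assumes "verts G \<noteq> {}"
  obtains K where "is_clique G K" "card K = clique_number G" "card K > 0"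
proof -
  let ?C = "{card K | K. is_clique G K}"
  have "?C = card ` {K. is_clique G K}" by auto
  moreover have "finite {K. is_clique G K}"
    by (rule finite_subset[of _ "Pow (verts G)"]) (auto simp: is_clique_def)
  ultimately have fin: "finite ?C" by simp
  obtain v where "v \<in> verts G" using assms by blast
  then have "is_clique G {v}" by (simp add: is_clique_def)
  then have "card {v} \<in> ?C" by blast
  then have 1: "1 \<in> ?C" by simp
  have "clique_number G \<in> ?C"
    unfolding clique_number_def by (rule Max_in) (use fin 1 in blast)+
  moreover have "1 \<le> clique_number G"
    unfolding clique_number_def using fin 1 by (rule Max_ge)
  ultimately show thesis using that by auto
qed

lemma sum_adj_diff:
  assumes "u \<in> verts G" "K \<subseteq> verts G"
  shows "(\<Sum>v\<in>verts G - K. adj G u v) = real (out_degree G u) - (\<Sum>v\<in>K. adj G u v)"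
  unfolding out_degree_eq_card sum_adj_eq_card[OF finite_verts, symmetric]
  using assms by (simp only: sum_diff[OF finite_verts])

end

theorem theorem12:
  fixes G :: "('a, 'b) pre_digraph"
    and n \<Delta> :: nat
    and \<mu> :: real
  assumes "graph G"
    and "Digraph_Component.connected G"
    and "n = card (verts G)"
    and "\<not> complete_digraph n G"
    and "\<Delta> = max_degree G"
    and "\<mu> = algebraic_connectivity G"
  shows "real (clique_number G) \<le> real n * (real \<Delta> - \<mu> + 1) / (real n - \<mu>)"
proof -
  interpret graph G by fact
  \<comment> \<open>Arcs of a loopless graph join distinct vertices, so non-completeness can only
    come from a missing pair.\<close>
  have "arcs_ends G \<noteq> {(u, v). (u, v) \<in> verts G \<times> verts G \<and> u \<noteq> v}"
    using assms(1,3,4) by (auto simp: complete_digraph_def)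
  then obtain a b where ab: "a \<in> verts G" "b \<in> verts G" "a \<noteq> b" "\<not> (a \<rightarrow>\<^bsub>G\<^esub> b)"
    by (auto dest: adj_in_verts adj_not_same)
  have n: "2 \<le> n"
    using card_mono[OF finite_verts, of "{a, b}"] ab assms(3) by simp
  note cut = cut_bound[OF assms(2) n[unfolded assms(3)], folded assms(3) assms(6)]
  \<comment> \<open>Positivity of the denominator. Since \<open>a\<close> is adjacent neither to
    itself nor to \<open>b\<close>, its degree is at most n - 2, and the cut at \<open>{a}\<close>
    gives \<mu> (n - 1) \<le> n (n - 2) < n (n - 1).\<close>
  have "\<mu> < n"
  proof -
    have "card {v \<in> verts G. a \<rightarrow>\<^bsub>G\<^esub> v} \<le> card (verts G - {a, b})"
      using ab by (intro card_mono) (auto dest: adj_not_same)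
    also have "\<dots> = n - 2"
      using ab assms(3) by (simp add: card_Diff_subset)
    finally have deg: "out_degree G a \<le> n - 2"
      by (simp add: out_degree_eq_card)
    have "\<mu> * (real n - 1) \<le> n * (\<Sum>v\<in>verts G - {a}. adj G a v)"
      using cut[of "{a}"] ab by simp
    also have "(\<Sum>v\<in>verts G - {a}. adj G a v) = out_degree G a - (\<Sum>v\<in>{a}. adj G a v)"
      using ab by (intro sum_adj_diff) auto
    also have "n * \<dots> \<le> n * (real n - 2)"
      using deg n by (intro mult_left_mono) auto
    also have "\<dots> < n * (real n - 1)"
      using n by simp
    finally show ?thesis
      using n by simp
  qed
  obtain K where K: "is_clique G K" "card K = clique_number G" "card K > 0"
    using clique_number_attained ab by blast
  define k where "k = real (card K)"
  have KV: "K \<subseteq> verts G" and finK: "finite K"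
    using K(1,3) by (auto simp: is_clique_def intro: card_ge_0_finite)
  \<comment> \<open>Of the at most \<Delta> neighbours of a clique vertex, exactly k - 1 lie inside
    the clique.\<close>
  have "(\<Sum>v\<in>verts G - K. adj G u v) \<le> \<Delta> - (k - 1)" if u: "u \<in> K" for u
  proof -
    have nbrs: "{v \<in> K. u \<rightarrow>\<^bsub>G\<^esub> v} = K - {u}"
      using u K(1) by (auto simp: is_clique_def dest: adj_not_same)
    have "(\<Sum>v\<in>K. adj G u v) = k - 1"
      unfolding sum_adj_eq_card[OF finK] nbrs using u finK K(3) by (simp add: k_def of_nat_diff)
    then show ?thesis
      using sum_adj_diff[of u K] u KV out_degree_le_max_degree[of u] assms(5) by auto
  qed
  then have "(\<Sum>u\<in>K. \<Sum>v\<in>verts G - K. adj G u v) \<le> k * (\<Delta> - (k - 1))"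
    unfolding k_def by (rule sum_bounded_above)
  then have "n * (\<Sum>u\<in>K. \<Sum>v\<in>verts G - K. adj G u v) \<le> n * (k * (\<Delta> - (k - 1)))"
    by (intro mult_left_mono) auto
  with cut[OF KV] have "\<mu> * (k * (n - k)) \<le> n * (k * (\<Delta> - (k - 1)))"
    unfolding k_def by linarith
  then have "k * (\<mu> * (n - k)) \<le> k * (n * (\<Delta> - (k - 1)))"
    by (simp only: mult_ac)
  then have "\<mu> * (n - k) \<le> n * (\<Delta> - (k - 1))"
    using K(3) by (simp add: k_def)
  \<comment> \<open>Expand and collect the terms containing \<open>k\<close> on the left.\<close>
  then have "k * (n - \<mu>) \<le> n * (\<Delta> - \<mu> + 1)"
    by (simp add: algebra_simps)
  then show ?thesis
    using \<open>\<mu> < n\<close> K(2) by (simp add: k_def pos_le_divide_eq)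
qed

end
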